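(* Let $p$ be a prime number and let $f(x)=\sum_{i=0}^{n}a_ix^i$ with $a_0\neq 0$ be a polynomial of degree $n$ having integer coefficients. Assume that the $x$-Newton polygon of $f(x)$ with respect to the $p$-adic valuation $v_p$ has $\ell\geq 1$ edges with positive slopes, these slopes being $\lambda_j$, $1\leq j\leq \ell$. If $\lambda_j=\frac{r_j}{s_j}$ with $r_j,s_j$ positive integers and $\gcd(r_j,s_j)=1$ for $1\le j\le \ell$, then $f(x)$ has an irreducible factor over $\mathbb{Q}$ of degree at least $\max_{1\leq j\leq \ell}\{s_j\}$.
   Context: $v_p$ is the $p$-adic valuation of $\mathbb{Q}$, normalized so that $v_p(p)=1$. $x$-Newton polygon with respect to $v_p$: let $f(x)=\sum_{i=0}^{n}a_ix^i\in\mathbb{Z}[x]$ with $a_0\ne 0$ and $a_n\neq 0$. For $0\le i\le n$ with $a_{n-i}\neq 0$ let $P_i=(i,v_p(a_{n-i}))$. For distinct such points $P_i,P_j$ let $$\mu_{ij}=\frac{v_p(a_{n-j})-v_p(a_{n-i})}{j-i}\in\mathbb{Q},$$ the slope of the segment joining $P_i$ and $P_j$. Let $i_1$ be the largest index with $0<i_1\le n$ such that $\mu_{0i_1}=\min\{\mu_{0j}: 0<j\le n,\ a_{n-j}\ne 0\}$. If $i_1<n$, let $i_2$ be the largest index with $i_1<i_2\le n$ such that $\mu_{i_1i_2}=\min\{\mu_{i_1j}: i_1<j\le n,\ a_{n-j}\neq 0\}$. Continue in this way until an index $i_k=n$ is reached. The $x$-Newton polygon of $f(x)$ is then said to have $k$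 edges, whose slopes are $\mu_{0i_1},\mu_{i_1i_2},\dots,\mu_{i_{k-1}i_k}$ (these are strictly increasing). Some of these slopes may be non-positive; the $\lambda_j$ are the slopes of those edges whose slope is positive. *)

theory Defs
  imports "HOL-Computational_Algebra.Computational_Algebra"
begin

text \<open>
  The \<open>x\<close>-Newton polygon of \<open>f = \<Sum>i\<le>n. a\<^sub>i x^i\<close> with respect to the \<open>p\<close>-adic valuation is built
  from the points \<open>P\<^sub>i = (i, v\<^sub>p(a\<^bsub>n-i\<^esub>))\<close>, \<open>0 \<le> i \<le> n\<close>, \<open>a\<^bsub>n-i\<^esub> \<noteq> 0\<close>. Coefficients are read off
  starting from the leading one. On nonzero integers \<open>v\<^sub>p\<close> is \<^const>\<open>multiplicity\<close>; the value
  \<open>multiplicity p 0 = 0\<close> is never used, since the points with \<open>a\<^bsub>n-i\<^esub> = 0\<close> are left out.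
\<close>

definition np_height :: "nat \<Rightarrow> int poly \<Rightarrow> nat \<Rightarrow> nat" where
  "np_height p f i = multiplicity (int p) (coeff f (degree f - i))"

definition np_slope :: "nat \<Rightarrow> int poly \<Rightarrow> nat \<Rightarrow> nat \<Rightarrow> rat" where
  "np_slope p f i j =
     (of_nat (np_height p f j) - of_nat (np_height p f i)) / (of_nat j - of_nat i)"

definition np_later :: "int poly \<Rightarrow> nat \<Rightarrow> nat set" where
  "np_later f i = {j. i < j \<and> j \<le> degree f \<and> coeff f (degree f - j) \<noteq> 0}"

definition np_next :: "nat \<Rightarrow> int poly \<Rightarrow> nat \<Rightarrow> nat" where
  "np_next p f i =
     Max {j \<in> np_later f i. np_slope p f i j = Min (np_slope p f i ` np_later f i)}"

lemma finite_np_later [simp]: "finite (np_later f i)"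
  by (rule finite_subset[of _ "{..degree f}"]) (auto simp: np_later_def)

text \<open>For \<open>a\<^sub>0 \<noteq> 0\<close> the construction stops exactly when it has reached the index \<open>n\<close>.\<close>

lemma np_later_eq_empty_iff:
  assumes "coeff f 0 \<noteq> 0"
  shows "np_later f i = {} \<longleftrightarrow> degree f \<le> i"
proof
  assume "np_later f i = {}"
  then have "degree f \<notin> np_later f i" by simp
  with assms show "degree f \<le> i" by (simp add: np_later_def)
qed (auto simp: np_later_def)

lemma np_next_in_np_later:
  assumes "np_later f i \<noteq> {}"
  shows "np_next p f i \<in> np_later f i"
proof -
  let ?S = "{j \<in> np_later f i. np_slope p f i j = Min (np_slope p f i ` np_later f i)}"
  have "Min (np_slope p f i ` np_later f i) \<in> np_slope p f i ` np_later f i"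
    using assms by (intro Min_in) auto
  then have "?S \<noteq> {}" by auto
  then have "Max ?S \<in> ?S" by (intro Max_in) auto
  then show ?thesis by (simp add: np_next_def)
qed

text \<open>The slopes of the edges from the vertex with index \<open>i\<close> onwards, from left to right.\<close>

function np_slopes_from :: "nat \<Rightarrow> int poly \<Rightarrow> nat \<Rightarrow> rat list" where
  "np_slopes_from p f i =
     (if np_later f i = {} then []
      else np_slope p f i (np_next p f i) # np_slopes_from p f (np_next p f i))"
  by pat_completeness auto
termination
proof (relation "measure (\<lambda>(p, f, i). degree f - i)")
  fix p f i
  assume "np_later f i \<noteq> {}"
  from np_next_in_np_later[OF this, of p]
  show "((p, f, np_next p f i), (p, f, i)) \<in> measure (\<lambda>(p, f, i). degree f - i)"
    by (auto simp: np_later_def)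
qed simp

declare np_slopes_from.simps [simp del]

definition newton_slopes :: "nat \<Rightarrow> int poly \<Rightarrow> rat list" where
  "newton_slopes p f = np_slopes_from p f 0"

end

theory Submission imports Defs begin

text \<open>
  Fix a slope \<open>\<lambda> = r/s\<close> in lowest terms and weigh the monomial \<open>a x^i\<close> by \<open>s * v\<^sub>p(a) + r * i\<close>. This
  weight is additive on products of monomials. Call the set of exponents at which a polynomial has
  minimal weight its \<^emph>\<open>face\<close>. Three observations give the theorem.

  \<^item> Two exponents in one face differ by a multiple of \<open>s\<close>, because their weights agree and \<open>r\<close> is
    coprime to \<open>s\<close>. So a polynomial whose face has two elements has degree at least \<open>s\<close>
    (\<open>face_two_imp_degree\<close>).
  \<^item> If two polynomials each have a one-element face, then so does their product: the product of the
    two lightest monomials cannot be cancelled (\<open>face_mult_singleton\<close>). Hence if the face of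
    a product has several elements, so has the face of one of the factors, and splitting
    off factors over \<open>\<rat>\<close> until an irreducible one is left yields an irreducible factor of degree at
    least \<open>s\<close> (\<open>irreducible_factor_of_face_two\<close>). Denominators are harmless, as
    scaling a polynomial shifts all weights equally.
  \<^item> No point of the Newton polygon lies below the line through one of its edges. So an edge
    of slope \<open>r/s\<close> puts its two endpoints into the face (\<open>np_slopes_from_supporting_line\<close>).

  Applying this to an edge whose slope has the largest denominator gives the claim.
\<close>

section \<open>Faces of integer polynomials\<close>

definition weight :: "nat \<Rightarrow> nat \<Rightarrow> nat \<Rightarrow> int poly \<Rightarrow> nat \<Rightarrow> nat" where
  "weight p r s g i = s * multiplicity (int p) (coeff g i) + r * i"

definition face :: "nat \<Rightarrow> nat \<Rightarrow> nat \<Rightarrow> int poly \<Rightarrow> nat set" where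
  "face p r s g =
     {i. coeff g i \<noteq> 0 \<and> (\<forall>j. coeff g j \<noteq> 0 \<longrightarrow> weight p r s g i \<le> weight p r s g j)}"

lemma face_nonempty:
  assumes "g \<noteq> 0"
  shows "face p r s g \<noteq> {}"
proof -
  have "coeff g (degree g) \<noteq> 0" using assms by simp
  from ex_has_least_nat[of "\<lambda>i. coeff g i \<noteq> 0", OF this, of "weight p r s g"]
  show ?thesis by (auto simp: face_def)
qed

lemma weight_gt_of_face_singleton:
  assumes "face p r s g = {i}" "coeff g j \<noteq> 0" "j \<noteq> i"
  shows "weight p r s g i < weight p r s g j"
proof (rule ccontr)
  assume "\<not> weight p r s g i < weight p r s g j"
  moreover have "i \<in> face p r s g" using assms by simp
  ultimately have "j \<in> face p r s g"
    using assms(2) by (fastforce simp: face_def)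
  then show False using assms by simp
qed

lemma face_smult:
  assumes "prime p" "d \<noteq> 0"
  shows "face p r s (smult d g) = face p r s g"
proof -
  have "weight p r s (smult d g) i = s * multiplicity (int p) d + weight p r s g i"
    if "coeff g i \<noteq> 0" for i
    using assms that
    by (simp add: weight_def prime_elem_multiplicity_mult_distrib algebra_simps)
  then show ?thesis using assms by (auto simp: face_def)
qed

text \<open>
  Every monomial product other than the one of the two lightest monomials is strictly heavier than
  it. In degree \<open>i + j\<close> the lightest product therefore determines the valuation of the coefficient,
  and in any other degree a nonzero coefficient is at least as heavy as one of its summands.
\<close>

lemma face_mult_singleton:
  assumes p: "prime p" and s: "s > 0"
    and g: "face p r s g = {i}" and h: "face p r s h = {j}"
  shows "face p r s (g * h) = {i + j}"
proof -
  let ?v = "multiplicity (int p)"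
  let ?t = "\<lambda>k m. coeff g m * coeff h (k - m)"
  have pp: "prime_elem (int p)" using p by simp
  have nu: "\<not> is_unit (int p)" using pp by (rule prime_elem_not_unit)
  have ni: "coeff g i \<noteq> 0" and nj: "coeff h j \<noteq> 0"
    using g h by (auto simp: face_def)
  define V where "V = ?v (coeff g i) + ?v (coeff h j)"
  have heavier: "s * V + r * (i + j) < s * ?v (?t k m) + r * k"
    if "?t k m \<noteq> 0" "m \<le> k" "(m, k - m) \<noteq> (i, j)" for k m
  proof -
    have m: "coeff g m \<noteq> 0" "coeff h (k - m) \<noteq> 0" using that by auto
    have v: "?v (?t k m) = ?v (coeff g m) + ?v (coeff h (k - m))"
      using m by (simp add: prime_elem_multiplicity_mult_distrib[OF pp])
    have "weight p r s g i + weight p r s h j < weight p r s g m + weight p r s h (k - m)"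
    proof (cases "m = i")
      case True
      then have "weight p r s h j < weight p r s h (k - m)"
        using that m by (intro weight_gt_of_face_singleton[OF h]) auto
      then show ?thesis using True by simp
    next
      case False
      have "weight p r s h j \<le> weight p r s h (k - m)"
        using weight_gt_of_face_singleton[OF h m(2)] by (cases "k - m = j") auto
      then show ?thesis using weight_gt_of_face_singleton[OF g m(1) False] by simp
    qed
    moreover have "r * m + r * (k - m) = r * k"
      using \<open>m \<le> k\<close> by (simp flip: add_mult_distrib2)
    ultimately show ?thesis
      unfolding weight_def V_def v by (simp add: algebra_simps)
  qed
  have lead: "coeff (g * h) (i + j) \<noteq> 0 \<and> ?v (coeff (g * h) (i + j)) = V"
  proof -
    have split: "coeff (g * h) (i + j) =
        coeff g i * coeff h j + (\<Sum>m\<in>{..i + j} - {i}. ?t (i + j) m)"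
      by (simp add: coeff_mult sum.remove[of "{..i + j}" i])
    have rest: "int p ^ Suc V dvd (\<Sum>m\<in>{..i + j} - {i}. ?t (i + j) m)"
    proof (rule dvd_sum)
      fix m assume m: "m \<in> {..i + j} - {i}"
      show "int p ^ Suc V dvd ?t (i + j) m"
      proof (cases "?t (i + j) m = 0")
        case False
        then have "s * V < s * ?v (?t (i + j) m)" using heavier[OF False] m by simp
        then have "V < ?v (?t (i + j) m)" by simp
        then show ?thesis by (intro multiplicity_dvd') simp
      next
        case True
        then show ?thesis by (metis dvd_0_right)
      qed
    qed
    have v: "?v (coeff g i * coeff h j) = V"
      using ni nj by (simp add: V_def prime_elem_multiplicity_mult_distrib[OF pp])
    have "int p ^ V dvd coeff g i * coeff h j" using v multiplicity_dvd by metis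
    moreover have "int p ^ V dvd (\<Sum>m\<in>{..i + j} - {i}. ?t (i + j) m)"
      using rest by (rule power_le_dvd) simp
    ultimately have dvd: "int p ^ V dvd coeff (g * h) (i + j)"
      unfolding split by (rule dvd_add)
    have "\<not> int p ^ Suc V dvd coeff g i * coeff h j"
      using v ni nj nu by (auto simp: power_dvd_iff_le_multiplicity simp del: power_Suc)
    then have ndvd: "\<not> int p ^ Suc V dvd coeff (g * h) (i + j)"
      unfolding split using rest by (simp add: dvd_add_left_iff)
    show ?thesis using dvd ndvd by (auto intro: multiplicity_eqI)
  qed
  have off: "s * V + r * (i + j) < weight p r s (g * h) k"
    if nz: "coeff (g * h) k \<noteq> 0" and k: "k \<noteq> i + j" for k
  proof -
    let ?e = "?v (coeff (g * h) k)"
    \<comment> \<open>The ultrametric inequality: some summand has valuation at most that of the sum.\<close>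
    have "\<not> int p ^ Suc ?e dvd coeff (g * h) k"
      using nz nu by (simp add: power_dvd_iff_le_multiplicity del: power_Suc)
    then obtain m where m: "m \<le> k" "\<not> int p ^ Suc ?e dvd ?t k m"
      unfolding coeff_mult by (meson atMost_iff dvd_sum)
    then have nzt: "?t k m \<noteq> 0" by (metis dvd_0_right)
    then have "?v (?t k m) \<le> ?e"
      using m(2) nu by (simp add: power_dvd_iff_le_multiplicity del: power_Suc)
    then have "s * ?v (?t k m) + r * k \<le> s * ?e + r * k" by simp
    moreover have "(m, k - m) \<noteq> (i, j)" using m(1) k by auto
    ultimately show ?thesis
      unfolding weight_def using heavier[OF nzt m(1)] by linarith
  qed
  have "weight p r s (g * h) (i + j) = s * V + r * (i + j)"
    using lead by (simp add: weight_def)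
  then show ?thesis
    using lead off by (fastforce simp: face_def)
qed

lemma face_two_imp_degree:
  assumes "coprime r s" "i \<in> face p r s g" "j \<in> face p r s g" "i \<noteq> j"
  shows "s \<le> degree g"
proof -
  have main: "s \<le> degree g"
    if "i < j" "i \<in> face p r s g" "j \<in> face p r s g" for i j
  proof -
    let ?v = "multiplicity (int p)"
    have "weight p r s g i = weight p r s g j"
      using that by (auto simp: face_def intro: antisym)
    then have "s * ?v (coeff g i) = s * ?v (coeff g j) + r * (j - i)"
      using \<open>i < j\<close> by (simp add: weight_def diff_mult_distrib2)
    then have "s dvd r * (j - i)"
      by (metis dvd_add_right_iff dvd_triv_left)
    then have "s dvd j - i"
      using assms(1) by (simp add: coprime_commute coprime_dvd_mult_right_iff)
    then have "s \<le> j" using \<open>i < j\<close> by (auto dest: dvd_imp_le)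
    also have "j \<le> degree g" using that by (auto simp: face_def intro: le_degree)
    finally show ?thesis .
  qed
  show ?thesis using main[of i j] main[of j i] assms by linarith
qed

section \<open>Irreducible factors over the rationals\<close>

lemma clear_denominators:
  fixes g :: "rat poly"
  obtains d :: int and q :: "int poly"
  where "d \<noteq> 0" "smult (of_int d) g = map_poly of_int q"
proof -
  have "\<exists>d q. d \<noteq> 0 \<and> smult (of_int d) g = map_poly of_int q"
  proof (induction g)
    case 0
    show ?case by (intro exI[of _ 1] exI[of _ 0]) simp
  next
    case (pCons a g)
    then obtain d q where dq: "d \<noteq> 0" "smult (of_int d) g = map_poly of_int q" by blast
    obtain x y where xy: "a = of_int x / of_int y" "y > 0"
      by (metis quotient_of_div quotient_of_denom_pos surj_pair)
    have "smult (of_int (d * y)) (pCons a g) = map_poly of_int (pCons (d * x) (smult y q))"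
    proof (rule poly_eqI)
      fix n
      have "of_int d * coeff g m = of_int (coeff q m)" for m
        using arg_cong[OF dq(2), of "\<lambda>u. coeff u m"] by (simp add: coeff_map_poly)
      then show "coeff (smult (of_int (d * y)) (pCons a g)) n =
          coeff (map_poly of_int (pCons (d * x) (smult y q))) n"
        using xy by (cases n) (simp_all add: coeff_map_poly algebra_simps)
    qed
    then show ?case using dq xy by (metis less_irrefl mult_eq_0_iff)
  qed
  then show ?thesis using that by blast
qed

lemma of_int_poly_mult:
  "map_poly (of_int :: int \<Rightarrow> rat) (g * h) = map_poly of_int g * map_poly of_int h"
  by (rule poly_eqI) (simp add: coeff_map_poly coeff_mult)

lemma of_int_poly_inject:
  "map_poly (of_int :: int \<Rightarrow> rat) g = map_poly of_int h \<longleftrightarrow> g = h"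
  by (simp add: poly_eq_iff coeff_map_poly)

lemma degree_of_int_poly: "degree (map_poly (of_int :: int \<Rightarrow> rat) g) = degree g"
  by (rule degree_map_poly) simp

lemma irreducible_factor_of_face_two:
  assumes p: "prime p" and s: "s > 0" and rs: "coprime r s"
    and "f \<noteq> 0" "i \<in> face p r s f" "j \<in> face p r s f" "i \<noteq> j"
  shows "\<exists>g :: rat poly. irreducible g \<and> g dvd map_poly of_int f \<and> s \<le> degree g"
  using assms(4-)
proof (induction "degree f" arbitrary: f i j rule: less_induct)
  case less
  let ?F = "map_poly of_int f :: rat poly"
  have deg: "s \<le> degree f" using face_two_imp_degree[OF rs] less.prems by blast
  show ?case
  proof (cases "irreducible ?F")
    case True
    then show ?thesis using deg by (intro exI[of _ ?F]) (simp add: degree_of_int_poly)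
  next
    case False
    have F0: "?F \<noteq> 0" using less.prems of_int_poly_inject[of f 0] by simp
    have "\<not> is_unit ?F"
      using deg s by (auto simp: is_unit_iff_degree[OF F0] degree_of_int_poly)
    with False F0 obtain g h where gh: "?F = g * h" "\<not> is_unit g" "\<not> is_unit h"
      unfolding irreducible_def by blast
    have g0: "g \<noteq> 0" and h0: "h \<noteq> 0" using F0 gh by auto
    have "degree g > 0" "degree h > 0"
      using gh g0 h0 by (auto simp: is_unit_iff_degree)
    moreover have "degree f = degree g + degree h"
      using degree_mult_eq[OF g0 h0] gh(1) degree_of_int_poly[of f] by simp
    ultimately have lt: "degree g < degree f" "degree h < degree f" by auto
    obtain a g' where g': "a \<noteq> 0" "smult (of_int a) g = map_poly of_int g'"
      by (rule clear_denominators)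
    obtain b h' where h': "b \<noteq> 0" "smult (of_int b) h = map_poly of_int h'"
      by (rule clear_denominators)
    have "map_poly (of_int :: int \<Rightarrow> rat) (smult (a * b) f) = smult (of_int a) g * smult (of_int b) h"
      by (simp add: map_poly_smult gh(1) mult.commute)
    then have prod: "smult (a * b) f = g' * h'"
      by (simp add: g' h' of_int_poly_mult[symmetric] of_int_poly_inject)
    then have "face p r s (g' * h') = face p r s f"
      using face_smult[OF p, of "a * b" r s f] g' h' by (metis mult_eq_0_iff)
    then have "\<not> (\<exists>k. face p r s (g' * h') = {k})"
      using less.prems by (metis singletonD)
    then have "\<not> ((\<exists>k. face p r s g' = {k}) \<and> (\<exists>k. face p r s h' = {k}))"
      using face_mult_singleton[OF p s] by blast
    moreover have n0: "g' \<noteq> 0" "h' \<noteq> 0"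
      using prod g' h' less.prems by auto
    moreover have two: "\<exists>i j. i \<in> A \<and> j \<in> A \<and> i \<noteq> j"
      if "A \<noteq> {}" "\<not> (\<exists>k. A = {k})" for A :: "nat set"
      using that by blast
    ultimately consider i j where "i \<in> face p r s g'" "j \<in> face p r s g'" "i \<noteq> j"
      | i j where "i \<in> face p r s h'" "j \<in> face p r s h'" "i \<noteq> j"
      using face_nonempty by metis
    then show ?thesis
    proof cases
      case 1
      have "degree g' < degree f"
        using lt g' degree_of_int_poly[of g'] by (metis degree_smult_eq of_int_eq_0_iff)
      from less.hyps[OF this n0(1) 1] obtain q :: "rat poly"
        where q: "irreducible q" "q dvd smult (of_int a) g" "s \<le> degree q"
        unfolding g' by blast
      then have "q dvd ?F" using dvd_smult_cancel[OF q(2)] g'(1) gh(1) by (simp add: dvd_mult2)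
      then show ?thesis using q by blast
    next
      case 2
      have "degree h' < degree f"
        using lt h' degree_of_int_poly[of h'] by (metis degree_smult_eq of_int_eq_0_iff)
      from less.hyps[OF this n0(2) 2] obtain q :: "rat poly"
        where q: "irreducible q" "q dvd smult (of_int b) h" "s \<le> degree q"
        unfolding h' by blast
      then have "q dvd ?F" using dvd_smult_cancel[OF q(2)] h'(1) gh(1) by simp
      then show ?thesis using q by blast
    qed
  qed
qed

section \<open>Edges of the Newton polygon\<close>

lemma np_slope_np_next:
  assumes "np_later f i \<noteq> {}"
  shows "np_slope p f i (np_next p f i) = Min (np_slope p f i ` np_later f i)"
proof -
  let ?S = "{j \<in> np_later f i. np_slope p f i j = Min (np_slope p f i ` np_later f i)}"
  have "Min (np_slope p f i ` np_later f i) \<in> np_slope p f i ` np_later f i"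
    using assms by (intro Min_in) auto
  then have "?S \<noteq> {}" by auto
  then have "Max ?S \<in> ?S" by (intro Max_in) auto
  then show ?thesis by (simp add: np_next_def)
qed

lemma np_height_eq_np_slope:
  assumes "i \<noteq> j"
  shows "rat_of_nat (np_height p f j) =
    of_nat (np_height p f i) + np_slope p f i j * (of_nat j - of_nat i)"
  using assms by (simp add: np_slope_def)

text \<open>
  The minimality of the slope only compares a vertex with the points to its right. The invariant
  \<open>inv\<close>, which passes from each vertex to the next, covers the points to its left: seen
  from the vertex, they lie on or above every line that continues to a later point.
\<close>

lemma np_slopes_from_supporting_line:
  fixes p f
  defines "y \<equiv> \<lambda>i. rat_of_nat (np_height p f i)"
  defines "supp \<equiv> \<lambda>i. i \<le> degree f \<and> coeff f (degree f - i) \<noteq> 0"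
  assumes "supp i"
    and inv: "\<And>k j. supp k \<Longrightarrow> k < i \<Longrightarrow> j \<in> np_later f i \<Longrightarrow>
      y i - y k \<le> np_slope p f i j * (of_nat i - of_nat k)"
    and "\<mu> \<in> set (np_slopes_from p f i)"
  shows "\<exists>a b. a < b \<and> supp a \<and> supp b \<and> y b - \<mu> * of_nat b = y a - \<mu> * of_nat a \<and>
    (\<forall>k. supp k \<longrightarrow> y a - \<mu> * of_nat a \<le> y k - \<mu> * of_nat k)"
  using assms(3-)
proof (induction "degree f - i" arbitrary: i rule: less_induct)
  case less
  define i' where "i' = np_next p f i"
  define m where "m = np_slope p f i i'"
  have ne: "np_later f i \<noteq> {}"
    using less.prems(3) by (auto simp: np_slopes_from.simps[of p f i])
  have later: "i' \<in> np_later f i" using np_next_in_np_later[OF ne] by (simp add: i'_def)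
  then have lt: "i < i'" and supp': "supp i'" by (auto simp: np_later_def supp_def)
  have min: "m \<le> np_slope p f i j" if "j \<in> np_later f i" for j
    using that np_slope_np_next[OF ne, of p] by (simp add: m_def i'_def)
  have yi': "y i' = y i + m * (of_nat i' - of_nat i)"
    unfolding y_def m_def using lt by (intro np_height_eq_np_slope) simp
  have line: "y i - m * of_nat i \<le> y k - m * of_nat k" if k: "supp k" for k
  proof (cases i k rule: linorder_cases)
    case less
    then have "k \<in> np_later f i" using k by (auto simp: np_later_def supp_def)
    then have "m * (of_nat k - of_nat i) \<le> np_slope p f i k * (of_nat k - of_nat i)"
      using min less by (intro mult_right_mono) auto
    then show ?thesis
      using np_height_eq_np_slope[of i k p f] less by (simp add: y_def algebra_simps)
  next
    case greater
    then show ?thesis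
      using less.prems(2)[OF k greater later] by (simp add: m_def algebra_simps)
  qed simp
  have line': "y i' - m * of_nat i' \<le> y k - m * of_nat k" if "supp k" for k
    using line[OF that] yi' by (simp add: algebra_simps)
  consider "\<mu> = m" | "\<mu> \<in> set (np_slopes_from p f i')"
    using less.prems(3) ne by (auto simp: np_slopes_from.simps[of p f i] m_def i'_def)
  then show ?case
  proof cases
    case 1
    then show ?thesis
      using lt supp' less.prems(1) line yi'
      by (intro exI[of _ i] exI[of _ i']) (simp add: algebra_simps)
  next
    case 2
    have "y i' - y k \<le> np_slope p f i' j * (of_nat i' - of_nat k)"
      if "supp k" "k < i'" "j \<in> np_later f i'" for k j
    proof -
      have j: "i' < j" "supp j" using that by (auto simp: np_later_def supp_def)
      have "m * (of_nat j - of_nat i') \<le> np_slope p f i' j * (of_nat j - of_nat i')"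
        using line'[OF j(2)] np_height_eq_np_slope[of i' j p f] j(1)
        by (simp add: y_def algebra_simps)
      then have "m \<le> np_slope p f i' j" using j(1) by simp
      then have "m * (of_nat i' - of_nat k) \<le> np_slope p f i' j * (of_nat i' - of_nat k)"
        using that by (intro mult_right_mono) auto
      then show ?thesis using line'[OF that(1)] by (simp add: algebra_simps)
    qed
    moreover have "degree f - i' < degree f - i"
      using lt supp' by (auto simp: supp_def)
    ultimately show ?thesis using less.hyps[of i'] supp' 2 by blast
  qed
qed

text \<open>
  Newton polygon points are indexed from the leading coefficient downwards. Under \<open>i \<mapsto> n - i\<close> the
  supporting line of slope \<open>r/s\<close> becomes the condition of minimal weight.
\<close>

lemma face_two_of_newton_slope:
  assumes f: "f \<noteq> 0" and s: "s > 0"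
    and slope: "of_nat r / of_nat s \<in> set (newton_slopes p f)"
  shows "\<exists>i j. i \<in> face p r s f \<and> j \<in> face p r s f \<and> i \<noteq> j"
proof -
  let ?n = "degree f"
  let ?\<mu> = "rat_of_nat r / of_nat s"
  let ?y = "\<lambda>i. rat_of_nat (np_height p f i)"
  let ?supp = "\<lambda>i. i \<le> ?n \<and> coeff f (?n - i) \<noteq> 0"
  obtain a b where ab: "a < b" "?supp a" "?supp b"
      and eq: "?y b - ?\<mu> * of_nat b = ?y a - ?\<mu> * of_nat a"
      and min: "\<And>k. ?supp k \<Longrightarrow> ?y a - ?\<mu> * of_nat a \<le> ?y k - ?\<mu> * of_nat k"
    using np_slopes_from_supporting_line[of 0 f p ?\<mu>] f slope
    by (auto simp: newton_slopes_def)
  have weight: "rat_of_nat (weight p r s f (?n - i)) =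
      of_nat s * (?y i - ?\<mu> * of_nat i) + of_nat r * of_nat ?n" if "i \<le> ?n" for i
    using that s by (simp add: weight_def np_height_def of_nat_diff field_simps)
  have face: "?n - i \<in> face p r s f"
    if i: "?supp i" and le: "\<And>k. ?supp k \<Longrightarrow> ?y i - ?\<mu> * of_nat i \<le> ?y k - ?\<mu> * of_nat k" for i
  proof -
    have "weight p r s f (?n - i) \<le> weight p r s f j" if j: "coeff f j \<noteq> 0" for j
    proof -
      have jn: "j \<le> ?n" using j by (rule le_degree)
      then have sj: "?supp (?n - j)" using j by simp
      have "of_nat s * (?y i - ?\<mu> * of_nat i)
          \<le> of_nat s * (?y (?n - j) - ?\<mu> * of_nat (?n - j))"
        by (intro mult_left_mono le[OF sj]) simp
      then have "rat_of_nat (weight p r s f (?n - i)) \<le> of_nat (weight p r s f (?n - (?n - j)))"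
        using weight[of i] weight[of "?n - j"] i by simp
      then show ?thesis using jn by simp
    qed
    then show ?thesis using i by (simp add: face_def)
  qed
  have "?n - a \<in> face p r s f" by (rule face[OF ab(2) min])
  moreover have "?n - b \<in> face p r s f"
    using face[OF ab(3)] min unfolding eq by blast
  moreover have "?n - a \<noteq> ?n - b" using ab by linarith
  ultimately show ?thesis by blast
qed

theorem theorem1p5:
  fixes p n l :: nat
    and f :: "int poly"
    and lam :: "nat \<Rightarrow> rat"
    and r s :: "nat \<Rightarrow> nat"
  assumes "prime p"
    and "degree f = n"
    and "coeff f 0 \<noteq> 0"
    and "l \<ge> 1"
    and "filter (\<lambda>m. m > 0) (newton_slopes p f) = map lam [1..<Suc l]"
    and "\<And>j. j \<in> {1..l} \<Longrightarrow>
           r j > 0 \<and> s j > 0 \<and> coprime (r j) (s j) \<and> lam j = of_nat (r j) / of_nat (s j)"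
  shows "\<exists>g :: rat poly. irreducible g \<and> g dvd map_poly of_int f \<and>
           degree g \<ge> Max (s ` {1..l})"
proof -
  have f0: "f \<noteq> 0" using assms(3) by auto
  have "Max (s ` {1..l}) \<in> s ` {1..l}" using assms(4) by (intro Max_in) auto
  then obtain j where j: "j \<in> {1..l}" "Max (s ` {1..l}) = s j" by auto
  have "lam j \<in> set (map lam [1..<Suc l])"
    unfolding set_map using j(1) by (intro imageI) auto
  then have "lam j \<in> set (newton_slopes p f)" unfolding assms(5)[symmetric] by simp
  then have slope: "of_nat (r j) / of_nat (s j) \<in> set (newton_slopes p f)"
    using assms(6)[OF j(1)] by simp
  have s: "s j > 0" and rs: "coprime (r j) (s j)" using assms(6)[OF j(1)] by auto
  show ?thesis
    using face_two_of_newton_slope[OF f0 s slope]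
      irreducible_factor_of_face_two[OF assms(1) s rs f0] j(2) by auto
qed

end
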